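(* If $\mathbf X=(X,\lambda_X,\rho_X)$ is a ditopological unosemigroup, then its Hartman-Mycielski extension $HM(\mathbf X)=(HM(X),\lambda_{HM(X)},\rho_{HM(X)})$ is a ditopological unosemigroup.
   Context: A topological semigroup is a non-empty topological space $S$ endowed with a continuous associative binary operation $\cdot:S\times S\to S$. A left (resp. right) unit operation on $S$ is a map $\lambda:S\to S$ with $\lambda(x)\cdot x=x$ (resp. a map $\rho:S\to S$ with $x\cdot\rho(x)=x$) for all $x\in S$. For $A,B\subset S$ put $A\leftthreetimes B=\{x\in S: ax\in B \text{ for some } a\in A\}$ and $B\rightthreetimes A=\{x\in S: xa\in B\text{ for some }a\in A\}$. A continuous left unit operation $\lambda$ is dicontinuous if for every $x\in S$ and every neighborhood $O_x\subset S$ of $x$ there are a neighborhood $U_x\subset S$ of $x$ and a neighborhood $W_{\lambda(x)}\subset\lambda(S)$ of $\lambda(x)$ in the subspace $\lambda(S)$ such that $(W_{\lambda(x)}\leftthreetimes U_x)\cap\lambda^{-1}(W_{\lambda(x)})\subset O_x$. A continuous right unit operation $\rho$ is dicontinuous if for every $x\in S$ and every neighborhood $O_x\subset S$ of $x$ there are a neighborhood $U_x\subset S$ of $x$ and a neighborhood $W_{\rho(x)}\subset\rho(S)$ of $\rho(x)$ in the subspace $\rho(S)$ such that $(U_x\rightthreetimes W_{\rho(x)})\cap\rho^{-1}(W_{\rho(x)})\subset O_x$. A ditopological unosemigroup $(S,\lambda,\rho)$ is a topological semigroup $S$ endowed with a dicontinuous left unit operation $\lambda$ and a dicontinuous right unit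 operation $\rho$. Hartman-Mycielski extension: for a topological space $X$, $HM(X)$ is the set of all functions $f:[0,1)\to X$ for which there are $n\in\mathbb N$ and $0=a_0<a_1<\dots<a_n=1$ such that $f$ is constant on each $[a_i,a_{i+1})$, $0\le i<n$. A neighborhood sub-base at $f\in HM(X)$ consists of the sets $N(a,b,V,\varepsilon)=\{g\in HM(X): |\{t\in[a,b): g(t)\notin V\}|<\varepsilon\}$, where $0\le a<b\le 1$, $f$ is constant on $[a,b)$, $V$ is a neighborhood of $f(a)$ in $X$, $\varepsilon>0$, and $|\cdot|$ is Lebesgue measure. If $X$ is a topological semigroup, $HM(X)$ is a topological semigroup under pointwise multiplication, and for continuous left and right unit operations $\lambda_X,\rho_X$ on $X$, the maps $\lambda_{HM(X)}(f)=\lambda_X\circ f$ and $\rho_{HM(X)}(f)=\rho_X\circ f$ are continuous left and right unit operations on $HM(X)$. *)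

theory Defs
  imports "HOL-Analysis.Analysis"
begin

text \<open>
  Spaces are abstract topologies with carrier \<^term>\<open>topspace S\<close>; operations are only
  constrained on the carrier. Neighborhoods need not be open.
\<close>

definition neighborhood_in :: "'a topology \<Rightarrow> 'a \<Rightarrow> 'a set \<Rightarrow> bool" where
  "neighborhood_in S x V \<longleftrightarrow> V \<subseteq> topspace S \<and> (\<exists>U. openin S U \<and> x \<in> U \<and> U \<subseteq> V)"

definition topological_semigroup :: "'a topology \<Rightarrow> ('a \<Rightarrow> 'a \<Rightarrow> 'a) \<Rightarrow> bool" where
  "topological_semigroup S m \<longleftrightarrow>
     topspace S \<noteq> {} \<and>
     continuous_map (prod_topology S S) S (\<lambda>(x, y). m x y) \<and>
     (\<forall>x\<in>topspace S. \<forall>y\<in>topspace S. \<forall>z\<in>topspace S. m (m x y) z = m x (m y z))"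

definition left_unit_operation :: "'a topology \<Rightarrow> ('a \<Rightarrow> 'a \<Rightarrow> 'a) \<Rightarrow> ('a \<Rightarrow> 'a) \<Rightarrow> bool" where
  "left_unit_operation S m l \<longleftrightarrow>
     l \<in> topspace S \<rightarrow> topspace S \<and> (\<forall>x\<in>topspace S. m (l x) x = x)"

definition right_unit_operation :: "'a topology \<Rightarrow> ('a \<Rightarrow> 'a \<Rightarrow> 'a) \<Rightarrow> ('a \<Rightarrow> 'a) \<Rightarrow> bool" where
  "right_unit_operation S m r \<longleftrightarrow>
     r \<in> topspace S \<rightarrow> topspace S \<and> (\<forall>x\<in>topspace S. m x (r x) = x)"

text \<open>The sets written $A \leftthreetimes B$ and $B \rightthreetimes A$, in this argument order.\<close>

definition left_quot :: "'a topology \<Rightarrow> ('a \<Rightarrow> 'a \<Rightarrow> 'a) \<Rightarrow> 'a set \<Rightarrow> 'a set \<Rightarrow> 'a set" where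
  "left_quot S m A B = {x \<in> topspace S. \<exists>a\<in>A. m a x \<in> B}"

definition right_quot :: "'a topology \<Rightarrow> ('a \<Rightarrow> 'a \<Rightarrow> 'a) \<Rightarrow> 'a set \<Rightarrow> 'a set \<Rightarrow> 'a set" where
  "right_quot S m B A = {x \<in> topspace S. \<exists>a\<in>A. m x a \<in> B}"

definition dicontinuous_left_unit_operation ::
    "'a topology \<Rightarrow> ('a \<Rightarrow> 'a \<Rightarrow> 'a) \<Rightarrow> ('a \<Rightarrow> 'a) \<Rightarrow> bool" where
  "dicontinuous_left_unit_operation S m l \<longleftrightarrow>
     left_unit_operation S m l \<and> continuous_map S S l \<and>
     (\<forall>x\<in>topspace S. \<forall>O1. neighborhood_in S x O1 \<longrightarrow>
        (\<exists>U W. neighborhood_in S x U \<and>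
           neighborhood_in (subtopology S (l ` topspace S)) (l x) W \<and>
           left_quot S m W U \<inter> {y \<in> topspace S. l y \<in> W} \<subseteq> O1))"

definition dicontinuous_right_unit_operation ::
    "'a topology \<Rightarrow> ('a \<Rightarrow> 'a \<Rightarrow> 'a) \<Rightarrow> ('a \<Rightarrow> 'a) \<Rightarrow> bool" where
  "dicontinuous_right_unit_operation S m r \<longleftrightarrow>
     right_unit_operation S m r \<and> continuous_map S S r \<and>
     (\<forall>x\<in>topspace S. \<forall>O1. neighborhood_in S x O1 \<longrightarrow>
        (\<exists>U W. neighborhood_in S x U \<and>
           neighborhood_in (subtopology S (r ` topspace S)) (r x) W \<and>
           right_quot S m U W \<inter> {y \<in> topspace S. r y \<in> W} \<subseteq> O1))"

definition ditopological_unosemigroup ::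
    "'a topology \<Rightarrow> ('a \<Rightarrow> 'a \<Rightarrow> 'a) \<Rightarrow> ('a \<Rightarrow> 'a) \<Rightarrow> ('a \<Rightarrow> 'a) \<Rightarrow> bool" where
  "ditopological_unosemigroup S m l r \<longleftrightarrow>
     topological_semigroup S m \<and>
     dicontinuous_left_unit_operation S m l \<and>
     dicontinuous_right_unit_operation S m r"

text \<open>
  Functions on $[0,1)$ are represented by total functions that are \<^const>\<open>undefined\<close>
  outside \<^term>\<open>{0..<1::real}\<close>, so that equality is equality on $[0,1)$.
\<close>

definition HM_set :: "'a topology \<Rightarrow> (real \<Rightarrow> 'a) set" where
  "HM_set X = {f \<in> {0..<1} \<rightarrow>\<^sub>E topspace X.
     \<exists>(n::nat) a. a 0 = 0 \<and> a n = 1 \<and> (\<forall>i<n. a i < a (Suc i)) \<and>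
       (\<forall>i<n. f constant_on {a i..<a (Suc i)})}"

definition HM_nbhd :: "'a topology \<Rightarrow> real \<Rightarrow> real \<Rightarrow> 'a set \<Rightarrow> real \<Rightarrow> (real \<Rightarrow> 'a) set" where
  "HM_nbhd X a b V \<epsilon> = {g \<in> HM_set X. measure lebesgue {t \<in> {a..<b}. g t \<notin> V} < \<epsilon>}"

definition HM_subbase :: "'a topology \<Rightarrow> (real \<Rightarrow> 'a) \<Rightarrow> (real \<Rightarrow> 'a) set set" where
  "HM_subbase X f = {HM_nbhd X a b V \<epsilon> | a b V \<epsilon>.
     0 \<le> a \<and> a < b \<and> b \<le> 1 \<and> f constant_on {a..<b} \<and> neighborhood_in X (f a) V \<and> \<epsilon> > 0}"

text \<open>
  The topology determined by the neighborhood sub-bases: a set is open iff it contains, for each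
  of its points, a finite intersection of sub-basic neighborhoods of that point (the empty
  intersection being the whole space). Lemma \<open>neighborhood_in_HM_iff\<close> below shows that
  these intersections are indeed a neighborhood base of the topology.
\<close>

definition HM_topology :: "'a topology \<Rightarrow> (real \<Rightarrow> 'a) topology" where
  "HM_topology X = topology (\<lambda>U. U \<subseteq> HM_set X \<and>
     (\<forall>f\<in>U. \<exists>F. finite F \<and> F \<subseteq> HM_subbase X f \<and> HM_set X \<inter> \<Inter>F \<subseteq> U))"

definition HM_mult :: "('a \<Rightarrow> 'a \<Rightarrow> 'a) \<Rightarrow> (real \<Rightarrow> 'a) \<Rightarrow> (real \<Rightarrow> 'a) \<Rightarrow> (real \<Rightarrow> 'a)" where
  "HM_mult m f g = (\<lambda>t\<in>{0..<1}. m (f t) (g t))"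

definition HM_map :: "('a \<Rightarrow> 'a) \<Rightarrow> (real \<Rightarrow> 'a) \<Rightarrow> (real \<Rightarrow> 'a)" where
  "HM_map u f = (\<lambda>t\<in>{0..<1}. u (f t))"

lemma openin_HM_topology:
  "openin (HM_topology X) U \<longleftrightarrow> U \<subseteq> HM_set X \<and>
     (\<forall>f\<in>U. \<exists>F. finite F \<and> F \<subseteq> HM_subbase X f \<and> HM_set X \<inter> \<Inter>F \<subseteq> U)"
proof -
  define Q where "Q U f \<longleftrightarrow>
    (\<exists>F. finite F \<and> F \<subseteq> HM_subbase X f \<and> HM_set X \<inter> \<Inter>F \<subseteq> U)" for U f
  have Int: "Q (U \<inter> V) f" if U: "Q U f" and V: "Q V f" for U V f
  proof -
    from U obtain F where F: "finite F" "F \<subseteq> HM_subbase X f" "HM_set X \<inter> \<Inter>F \<subseteq> U"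
      unfolding Q_def by blast
    from V obtain G where G: "finite G" "G \<subseteq> HM_subbase X f" "HM_set X \<inter> \<Inter>G \<subseteq> V"
      unfolding Q_def by blast
    have "HM_set X \<inter> \<Inter>(F \<union> G) \<subseteq> U \<inter> V"
      using F(3) G(3) unfolding Inter_Un_distrib by blast
    moreover have "finite (F \<union> G)" "F \<union> G \<subseteq> HM_subbase X f"
      using F G by simp_all
    ultimately show ?thesis unfolding Q_def by blast
  qed
  have mono: "Q V f" if "Q U f" "U \<subseteq> V" for U V f
    using that unfolding Q_def by (meson subset_trans)
  have "istopology (\<lambda>U. U \<subseteq> HM_set X \<and> (\<forall>f\<in>U. Q U f))"
    unfolding istopology_def
  proof (intro conjI allI impI)
    fix K assume K: "\<forall>U\<in>K. U \<subseteq> HM_set X \<and> (\<forall>f\<in>U. Q U f)"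
    show "\<forall>f\<in>\<Union>K. Q (\<Union>K) f"
      using K mono by (meson Union_iff Union_upper)
    show "\<Union>K \<subseteq> HM_set X" using K by blast
  qed (use Int in auto)
  then have "openin (HM_topology X) U \<longleftrightarrow> U \<subseteq> HM_set X \<and> (\<forall>f\<in>U. Q U f)"
    unfolding HM_topology_def Q_def by (simp only: topology_inverse')
  then show ?thesis unfolding Q_def .
qed

lemma topspace_HM_topology [simp]: "topspace (HM_topology X) = HM_set X"
proof (rule subset_antisym)
  show "topspace (HM_topology X) \<subseteq> HM_set X"
    using openin_topspace[of "HM_topology X"] unfolding openin_HM_topology by (rule conjunct1)
  have "openin (HM_topology X) (HM_set X)"
    unfolding openin_HM_topology by (auto intro!: exI[of _ "{}"])
  then show "HM_set X \<subseteq> topspace (HM_topology X)"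
    by (rule openin_subset)
qed

lemma HM_set_partition:
  assumes "g \<in> HM_set X"
  obtains n :: nat and c :: "nat \<Rightarrow> real" where
    "c 0 = 0" "c n = 1" "\<forall>t\<in>{0..<1}. \<exists>i<n. t \<in> {c i..<c (Suc i)}"
    "\<forall>i<n. \<forall>t\<in>{c i..<c (Suc i)}. g t = g (c i)"
    "\<forall>i<n. c i \<in> {0..<1}"
proof -
  from assms obtain n :: nat and c :: "nat \<Rightarrow> real" where c: "c 0 = 0" "c n = 1"
    "\<And>i. i < n \<Longrightarrow> c i < c (Suc i)" "\<And>i. i < n \<Longrightarrow> g constant_on {c i..<c (Suc i)}"
    unfolding HM_set_def by blast
  have mono: "c i \<le> c j" if "i \<le> j" "j \<le> n" for i j
    using that
  proof (induction j)
    case (Suc j)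
    then show ?case using c(3)[of j] by (cases "i = Suc j") auto
  qed simp
  have part: "\<exists>i<k. t \<in> {c i..<c (Suc i)}" if "k \<le> n" "0 \<le> t" "t < c k" for k t
    using that
  proof (induction k)
    case (Suc k)
    then show ?case by (cases "t < c k") (auto intro: less_SucI)
  qed (use c in simp)
  show thesis
  proof (rule that)
    show "\<forall>t\<in>{0..<1}. \<exists>i<n. t \<in> {c i..<c (Suc i)}"
      using part[of n] c(2) by simp
    have "g t = g (c i)" if "i < n" "t \<in> {c i..<c (Suc i)}" for i t
      using c(4)[OF that(1)] that c(3)[OF that(1)] unfolding constant_on_def by auto
    then show "\<forall>i<n. \<forall>t\<in>{c i..<c (Suc i)}. g t = g (c i)" by blast
    have "c i \<in> {0..<1}" if "i < n" for i
      using mono[of 0 i] mono[of "Suc i" n] c(1,2) c(3)[OF that] that by auto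
    then show "\<forall>i<n. c i \<in> {0..<1}" by blast
  qed (use c in auto)
qed

lemma HM_bad_set_borel:
  assumes "g \<in> HM_set X" "0 \<le> a" "b \<le> 1"
  shows "{t \<in> {a..<b}. g t \<notin> V} \<in> sets borel"
proof -
  obtain c :: "nat \<Rightarrow> real" and n :: nat where
    c0: "c 0 = 0" "c n = 1" and
    c: "\<forall>t\<in>{0..<1}. \<exists>i<n. t \<in> {c i..<c (Suc i)}"
    "\<forall>i<n. \<forall>t\<in>{c i..<c (Suc i)}. g t = g (c i)"
    "\<forall>i<n. c i \<in> {0..<1}"
    by (rule HM_set_partition[OF assms(1)]) (rule that)
  have "{t \<in> {a..<b}. g t \<notin> V} = (\<Union>i\<in>{i. i < n \<and> g (c i) \<notin> V}. {a..<b} \<inter> {c i..<c (Suc i)})"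
  proof safe
    fix t assume t: "t \<in> {a..<b}" "g t \<notin> V"
    then have "t \<in> {0..<1}" using assms by auto
    with c(1) obtain i where i: "i < n" "t \<in> {c i..<c (Suc i)}" by blast
    with c(2) have "g t = g (c i)" by blast
    with t i show "t \<in> (\<Union>i\<in>{i. i < n \<and> g (c i) \<notin> V}. {a..<b} \<inter> {c i..<c (Suc i)})"
      by auto
  next
    fix t i assume "t \<in> {c i..<c (Suc i)}" "i < n" "g (c i) \<notin> V" "g t \<in> V"
    then show False using c(2) by metis
  qed
  moreover have "\<dots> \<in> sets borel"
    by (intro sets.finite_UN) auto
  ultimately show ?thesis by simp
qed

lemma HM_bad_set_lmeasurable:
  assumes "g \<in> HM_set X" "0 \<le> a" "b \<le> 1"
  shows "{t \<in> {a..<b}. g t \<notin> V} \<in> lmeasurable"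
proof (rule bounded_set_imp_lmeasurable)
  show "bounded {t \<in> {a..<b}. g t \<notin> V}"
    by (rule bounded_subset[of "{a..b}"]) auto
  show "{t \<in> {a..<b}. g t \<notin> V} \<in> sets lebesgue"
    by (rule sets_completionI_sets) (simp only: sets_lborel HM_bad_set_borel[OF assms])
qed

lemma openin_HM_nbhd:
  assumes "0 \<le> a" "a < b" "b \<le> 1" "openin X V"
  shows "openin (HM_topology X) (HM_nbhd X a b V \<epsilon>)"
  unfolding openin_HM_topology
proof (intro conjI ballI)
  show "HM_nbhd X a b V \<epsilon> \<subseteq> HM_set X" by (auto simp: HM_nbhd_def)
next
  fix g assume g: "g \<in> HM_nbhd X a b V \<epsilon>"
  then have gH: "g \<in> HM_set X" by (simp add: HM_nbhd_def)
  obtain c :: "nat \<Rightarrow> real" and n :: nat where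
    c0: "c 0 = 0" "c n = 1" and
    c: "\<forall>t\<in>{0..<1}. \<exists>i<n. t \<in> {c i..<c (Suc i)}"
    "\<forall>i<n. \<forall>t\<in>{c i..<c (Suc i)}. g t = g (c i)"
    "\<forall>i<n. c i \<in> {0..<1}"
    by (rule HM_set_partition[OF gH]) (rule that)
  define B where "B = {t \<in> {a..<b}. g t \<notin> V}"
  define \<delta> where "\<delta> = (\<epsilon> - measure lebesgue B) / n"
  have "n > 0" using c0 by (cases n) auto
  have gap: "measure lebesgue B < \<epsilon>" using g by (simp add: HM_nbhd_def B_def)
  then have \<delta>: "\<delta> > 0" "n * \<delta> = \<epsilon> - measure lebesgue B"
    using \<open>n > 0\<close> by (auto simp: \<delta>_def)
  define p where "p i = max a (c i)" for i
  define q where "q i = min b (c (Suc i))" for i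
  define I where "I = {i. i < n \<and> p i < q i \<and> g (c i) \<in> V}"
  define F where "F = (\<lambda>i. HM_nbhd X (p i) (q i) V \<delta>) ` I"
  have I: "finite I" "card I \<le> n"
    using card_mono[of "{..<n}" I] by (auto simp: I_def)
  show "\<exists>F. finite F \<and> F \<subseteq> HM_subbase X g \<and> HM_set X \<inter> \<Inter>F \<subseteq> HM_nbhd X a b V \<epsilon>"
  proof (intro exI[of _ F] conjI)
    show "finite F" using I by (simp add: F_def)
    show "F \<subseteq> HM_subbase X g"
      unfolding F_def
    proof (rule image_subsetI)
      fix i assume "i \<in> I"
      then have i: "i < n" "p i < q i" "g (c i) \<in> V" by (auto simp: I_def)
      have eq: "g t = g (c i)" if "t \<in> {p i..<q i}" for t
      proof -
        have "t \<in> {c i..<c (Suc i)}" using that by (auto simp: p_def q_def)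
        with c(2) i(1) show ?thesis by blast
      qed
      have "g constant_on {p i..<q i}" using eq unfolding constant_on_def by blast
      moreover have "g (p i) \<in> V" using eq[of "p i"] i by simp
      then have "neighborhood_in X (g (p i)) V"
        using assms(4) openin_subset[OF assms(4)] by (auto simp: neighborhood_in_def)
      moreover have "0 \<le> p i" "q i \<le> 1" using assms by (auto simp: p_def q_def)
      ultimately show "HM_nbhd X (p i) (q i) V \<delta> \<in> HM_subbase X g"
        using i \<delta>(1) unfolding HM_subbase_def mem_Collect_eq
        by (intro exI[of _ "p i"] exI[of _ "q i"] exI[of _ V] exI[of _ \<delta>] conjI refl) simp_all
    qed
    show "HM_set X \<inter> \<Inter>F \<subseteq> HM_nbhd X a b V \<epsilon>"
    proof
      fix h assume h: "h \<in> HM_set X \<inter> \<Inter>F"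
      define D where "D i = {t \<in> {p i..<q i}. h t \<notin> V}" for i
      have hD: "measure lebesgue (D i) < \<delta>" if "i \<in> I" for i
        using h that by (auto simp: F_def HM_nbhd_def D_def)
      have mD: "D i \<in> lmeasurable" for i
        unfolding D_def using h assms by (intro HM_bad_set_lmeasurable) (auto simp: p_def q_def)
      have mB: "B \<in> lmeasurable"
        unfolding B_def using gH assms by (intro HM_bad_set_lmeasurable) auto
      have mH: "{t \<in> {a..<b}. h t \<notin> V} \<in> lmeasurable"
        using h assms by (intro HM_bad_set_lmeasurable) auto
      have mUn: "(\<Union>i\<in>I. D i) \<in> lmeasurable"
        using I mD by (intro fmeasurable.finite_UN) auto
      have sub: "{t \<in> {a..<b}. h t \<notin> V} \<subseteq> B \<union> (\<Union>i\<in>I. D i)"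
      proof
        fix t assume t: "t \<in> {t \<in> {a..<b}. h t \<notin> V}"
        then have "t \<in> {0..<1}" using assms by auto
        with c(1) obtain i where i: "i < n" "t \<in> {c i..<c (Suc i)}" by blast
        with c(2) have gt: "g t = g (c i)" by blast
        show "t \<in> B \<union> (\<Union>i\<in>I. D i)"
        proof (cases "g t \<in> V")
          case True
          then have "i \<in> I" "t \<in> D i"
            using t i gt by (auto simp: I_def D_def p_def q_def)
          then show ?thesis by blast
        qed (use t in \<open>auto simp: B_def\<close>)
      qed
      have "measure lebesgue {t \<in> {a..<b}. h t \<notin> V} \<le> measure lebesgue (B \<union> (\<Union>i\<in>I. D i))"
        using sub mH mB mUn by (intro measure_mono_fmeasurable) (auto intro: fmeasurableD)
      also have "\<dots> \<le> measure lebesgue B + measure lebesgue (\<Union>i\<in>I. D i)"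
        using mB mUn by (intro measure_Un_le) (auto intro: fmeasurableD)
      also have "measure lebesgue (\<Union>i\<in>I. D i) \<le> (\<Sum>i\<in>I. measure lebesgue (D i))"
        using I mD by (intro measure_UNION_le) (auto intro: fmeasurableD)
      finally have le: "measure lebesgue {t \<in> {a..<b}. h t \<notin> V} \<le>
        measure lebesgue B + (\<Sum>i\<in>I. measure lebesgue (D i))" by simp
      have "measure lebesgue B + (\<Sum>i\<in>I. measure lebesgue (D i)) < \<epsilon>"
      proof (cases "I = {}")
        case False
        have "(\<Sum>i\<in>I. measure lebesgue (D i)) < (\<Sum>i\<in>I. \<delta>)"
          using False I hD by (intro sum_strict_mono) auto
        also have "\<dots> \<le> n * \<delta>"
          using mult_right_mono[of "real (card I)" n \<delta>] I \<delta>(1) by simp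
        finally show ?thesis using \<delta>(2) by simp
      qed (use gap in simp)
      with le h show "h \<in> HM_nbhd X a b V \<epsilon>" by (simp add: HM_nbhd_def)
    qed
  qed
qed

lemma HM_nbhd_mono:
  assumes "V \<subseteq> V'" "0 \<le> a" "b \<le> 1"
  shows "HM_nbhd X a b V \<epsilon> \<subseteq> HM_nbhd X a b V' \<epsilon>"
proof
  fix g assume g: "g \<in> HM_nbhd X a b V \<epsilon>"
  then have "g \<in> HM_set X" by (simp add: HM_nbhd_def)
  then have "measure lebesgue {t \<in> {a..<b}. g t \<notin> V'} \<le> measure lebesgue {t \<in> {a..<b}. g t \<notin> V}"
    using assms by (intro measure_mono_fmeasurable HM_bad_set_lmeasurable
      HM_bad_set_lmeasurable[THEN fmeasurableD]) blast+
  with g show "g \<in> HM_nbhd X a b V' \<epsilon>" by (simp add: HM_nbhd_def)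
qed

lemma neighborhood_in_HM_subbase:
  assumes "f \<in> HM_set X" "N \<in> HM_subbase X f"
  shows "neighborhood_in (HM_topology X) f N"
proof -
  from assms(2) obtain a b V \<epsilon> where N: "N = HM_nbhd X a b V \<epsilon>" "0 \<le> a" "a < b" "b \<le> 1"
    "f constant_on {a..<b}" "neighborhood_in X (f a) V" "\<epsilon> > 0"
    unfolding HM_subbase_def mem_Collect_eq by (elim exE conjE) (rule that)
  from N(6) obtain U where U: "openin X U" "f a \<in> U" "U \<subseteq> V"
    unfolding neighborhood_in_def by blast
  from N(5) obtain y where y: "\<forall>t\<in>{a..<b}. f t = y" unfolding constant_on_def by blast
  moreover have "y \<in> U" using y U(2) N(3) by simp
  ultimately have "{t \<in> {a..<b}. f t \<notin> U} = {}" by auto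
  then have "f \<in> HM_nbhd X a b U \<epsilon>" using assms(1) N(7) by (simp only: HM_nbhd_def mem_Collect_eq measure_empty simp_thms)
  moreover have "N \<subseteq> topspace (HM_topology X)" using N(1) by (auto simp: HM_nbhd_def)
  ultimately show ?thesis
    unfolding neighborhood_in_def
    using openin_HM_nbhd[OF N(2-4) U(1), of \<epsilon>] HM_nbhd_mono[OF U(3) N(2,4), of X \<epsilon>]
    by (intro conjI exI[of _ "HM_nbhd X a b U \<epsilon>"]) (simp_all add: N(1))
qed

lemma neighborhood_in_HM_iff:
  assumes "f \<in> HM_set X"
  shows "neighborhood_in (HM_topology X) f N \<longleftrightarrow> N \<subseteq> HM_set X \<and>
    (\<exists>F. finite F \<and> F \<subseteq> HM_subbase X f \<and> HM_set X \<inter> \<Inter>F \<subseteq> N)" (is "?L \<longleftrightarrow> ?R")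
proof
  assume L: ?L
  then obtain U where U: "openin (HM_topology X) U" "f \<in> U" "U \<subseteq> N"
    unfolding neighborhood_in_def by (elim exE conjE)
  from U(1) have "\<forall>f\<in>U. \<exists>F. finite F \<and> F \<subseteq> HM_subbase X f \<and> HM_set X \<inter> \<Inter>F \<subseteq> U"
    unfolding openin_HM_topology by (rule conjunct2)
  from bspec[OF this U(2)] U(3)
  have "\<exists>F. finite F \<and> F \<subseteq> HM_subbase X f \<and> HM_set X \<inter> \<Inter>F \<subseteq> N"
    by (meson subset_trans)
  with L show ?R by (simp add: neighborhood_in_def)
next
  assume R: ?R
  then obtain F where F: "finite F" "F \<subseteq> HM_subbase X f" "HM_set X \<inter> \<Inter>F \<subseteq> N"
    by (elim exE conjE)
  have "\<exists>U. openin (HM_topology X) U \<and> f \<in> U \<and> U \<subseteq> M" if "M \<in> F" for M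
    using neighborhood_in_HM_subbase[OF assms subsetD[OF F(2) that]]
    unfolding neighborhood_in_def by (rule conjunct2)
  then obtain u where u: "\<And>M. M \<in> F \<Longrightarrow> openin (HM_topology X) (u M)"
    "\<And>M. M \<in> F \<Longrightarrow> f \<in> u M" "\<And>M. M \<in> F \<Longrightarrow> u M \<subseteq> M"
    by metis
  let ?U = "\<Inter>(insert (topspace (HM_topology X)) (u ` F))"
  have "openin (HM_topology X) ?U"
    by (rule openin_Inter) (use u(1) F(1) in \<open>auto simp del: topspace_HM_topology\<close>)
  moreover have "f \<in> ?U" using u(2) assms by simp
  moreover have "?U \<subseteq> HM_set X \<inter> \<Inter>F" using u(3) by fastforce
  then have "?U \<subseteq> N" using F(3) by (rule subset_trans)
  ultimately show ?L
    using conjunct1[OF R] unfolding neighborhood_in_def topspace_HM_topology by meson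
qed

end

theory Submission
  imports Defs
begin

text \<open>
  Since a step function \<open>f\<close> has finite range, the sets
  \<open>{g. measure {t. g t \<notin> V (f t)} < \<epsilon>}\<close>, where \<open>V\<close> assigns a neighborhood to each value of \<open>f\<close>,
  form a neighborhood base at \<open>f\<close>. In this description every condition on \<open>X\<close>
  of the form ``if some points lie in suitable neighborhoods, then another point lies in a given
  neighborhood'' transfers to \<open>HM X\<close>: choose the neighborhoods in \<open>X\<close> separately for each of the
  finitely many values involved, and note that the exceptional set of the conclusion is covered by
  the exceptional sets of the premises.
\<close>

section \<open>Neighborhoods\<close>

lemma neighborhood_inI:
  "openin S U \<Longrightarrow> x \<in> U \<Longrightarrow> U \<subseteq> V \<Longrightarrow> V \<subseteq> topspace S \<Longrightarrow> neighborhood_in S x V"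
  unfolding neighborhood_in_def by blast

lemma neighborhood_inE:
  assumes "neighborhood_in S x V"
  obtains U where "openin S U" "x \<in> U" "U \<subseteq> V" "V \<subseteq> topspace S"
  using assms unfolding neighborhood_in_def by blast

lemma openin_imp_neighborhood_in: "openin S U \<Longrightarrow> x \<in> U \<Longrightarrow> neighborhood_in S x U"
  by (rule neighborhood_inI) (auto dest: openin_subset)

lemma neighborhood_in_topspace: "x \<in> topspace S \<Longrightarrow> neighborhood_in S x (topspace S)"
  by (rule openin_imp_neighborhood_in) auto

lemma neighborhood_in_Int:
  assumes "neighborhood_in S x U" "neighborhood_in S x V"
  shows "neighborhood_in S x (U \<inter> V)"
proof -
  obtain U' V' where "openin S U'" "x \<in> U'" "U' \<subseteq> U" "U \<subseteq> topspace S"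
    "openin S V'" "x \<in> V'" "V' \<subseteq> V"
    using assms by (elim neighborhood_inE)
  then show ?thesis by (intro neighborhood_inI[of S "U' \<inter> V'"]) auto
qed

text \<open>The factor \<open>topspace S\<close> takes care of an empty index set, where the bare
  intersection is \<open>UNIV\<close> and may leave the carrier.\<close>

lemma neighborhood_in_finite_INT:
  assumes "finite I" "x \<in> topspace S" "\<And>i. i \<in> I \<Longrightarrow> neighborhood_in S x (V i)"
  shows "neighborhood_in S x (topspace S \<inter> (\<Inter>i\<in>I. V i))"
  using assms
proof (induction I)
  case (insert i I)
  then have "neighborhood_in S x (V i \<inter> (topspace S \<inter> (\<Inter>i\<in>I. V i)))"
    using neighborhood_in_Int by (metis insertI1 insertI2)
  moreover have "V i \<inter> (topspace S \<inter> (\<Inter>i\<in>I. V i)) = topspace S \<inter> (\<Inter>i\<in>insert i I. V i)"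
    by blast
  ultimately show ?case by simp
qed (simp add: neighborhood_in_topspace)

lemma neighborhood_in_prod_topology:
  "neighborhood_in (prod_topology S T) (x, y) N \<longleftrightarrow>
    N \<subseteq> topspace S \<times> topspace T \<and>
    (\<exists>U V. neighborhood_in S x U \<and> neighborhood_in T y V \<and> U \<times> V \<subseteq> N)" (is "?L \<longleftrightarrow> ?R")
proof
  assume ?L
  then obtain W where W: "openin (prod_topology S T) W" "(x, y) \<in> W" "W \<subseteq> N"
    and N: "N \<subseteq> topspace (prod_topology S T)"
    by (rule neighborhood_inE)
  from W(1,2) obtain U V where UV: "openin S U" "openin T V" "x \<in> U" "y \<in> V" "U \<times> V \<subseteq> W"
    unfolding openin_prod_topology_alt by (elim conjE allE impE exE) (assumption, blast)
  from UV(5) W(3) have "U \<times> V \<subseteq> N" by (rule subset_trans)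
  then show ?R
    using N openin_imp_neighborhood_in[OF UV(1,3)] openin_imp_neighborhood_in[OF UV(2,4)] by auto
next
  assume R: ?R
  then obtain U V where UV: "neighborhood_in S x U" "neighborhood_in T y V" "U \<times> V \<subseteq> N"
    by (elim conjE exE)
  obtain U' where U': "openin S U'" "x \<in> U'" "U' \<subseteq> U" using UV(1) by (rule neighborhood_inE)
  obtain V' where V': "openin T V'" "y \<in> V'" "V' \<subseteq> V" using UV(2) by (rule neighborhood_inE)
  show ?L
  proof (rule neighborhood_inI)
    show "openin (prod_topology S T) (U' \<times> V')"
      using U'(1) V'(1) by (simp add: openin_prod_Times_iff)
    show "U' \<times> V' \<subseteq> N" using UV(3) U'(3) V'(3) by blast
  qed (use R U'(2) V'(2) in auto)
qed

text \<open>Serves to trade neighborhoods in the image of a unit operation for traces of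
  neighborhoods in the whole space.\<close>

lemma neighborhood_in_subtopology:
  assumes "x \<in> A" "A \<subseteq> topspace S"
  shows "neighborhood_in (subtopology S A) x N \<longleftrightarrow>
    N \<subseteq> A \<and> (\<exists>V. neighborhood_in S x V \<and> V \<inter> A \<subseteq> N)" (is "?L \<longleftrightarrow> ?R")
proof
  assume ?L
  then obtain W where W: "openin (subtopology S A) W" "x \<in> W" "W \<subseteq> N"
    and N: "N \<subseteq> topspace (subtopology S A)"
    by (rule neighborhood_inE)
  from W(1) obtain V where V: "openin S V" "W = V \<inter> A" unfolding openin_subtopology by blast
  then have "neighborhood_in S x V" "V \<inter> A \<subseteq> N"
    using W(2,3) by (auto intro: openin_imp_neighborhood_in)
  with N show ?R by auto
next
  assume R: ?R
  then obtain V where V: "neighborhood_in S x V" "V \<inter> A \<subseteq> N" by (elim conjE exE)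
  obtain U where U: "openin S U" "x \<in> U" "U \<subseteq> V" using V(1) by (rule neighborhood_inE)
  show ?L
  proof (rule neighborhood_inI)
    show "openin (subtopology S A) (U \<inter> A)" using U(1) by (auto simp: openin_subtopology)
    show "U \<inter> A \<subseteq> N" using U(3) V(2) by blast
  qed (use R U(2) assms in auto)
qed

text \<open>Pointwise continuity with neighborhoods that need not be open, to match the base of the
  step function space. Forwards, take the preimage of an open set; backwards, each point of such a
  preimage has an open set around it inside the preimage.\<close>

lemma continuous_map_iff_neighborhood_in:
  "continuous_map S T f \<longleftrightarrow> f \<in> topspace S \<rightarrow> topspace T \<and>
    (\<forall>x\<in>topspace S. \<forall>V. neighborhood_in T (f x) V \<longrightarrow> (\<exists>U. neighborhood_in S x U \<and> f ` U \<subseteq> V))"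
  (is "?L \<longleftrightarrow> ?R")
proof
  assume L: ?L
  have "\<exists>U. neighborhood_in S x U \<and> f ` U \<subseteq> V" if x: "x \<in> topspace S"
    and V: "neighborhood_in T (f x) V" for x V
  proof -
    from V obtain W where W: "openin T W" "f x \<in> W" "W \<subseteq> V"
      unfolding neighborhood_in_def by blast
    have "openin S {y \<in> topspace S. f y \<in> W}"
      using L W(1) by (rule openin_continuous_map_preimage)
    then have "neighborhood_in S x {y \<in> topspace S. f y \<in> W}"
      using x W(2) unfolding neighborhood_in_def by blast
    moreover have "f ` {y \<in> topspace S. f y \<in> W} \<subseteq> V" using W(3) by blast
    ultimately show ?thesis by blast
  qed
  with L show ?R by (simp add: continuous_map_def)
next
  assume R: ?R
  have "openin S {x \<in> topspace S. f x \<in> V}" if V: "openin T V" for V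
  proof (subst openin_subopen, safe)
    fix x assume x: "x \<in> topspace S" "f x \<in> V"
    then have "neighborhood_in T (f x) V"
      using V openin_subset[OF V] unfolding neighborhood_in_def by blast
    with R x obtain U where "neighborhood_in S x U" "f ` U \<subseteq> V" by blast
    then show "\<exists>U. openin S U \<and> x \<in> U \<and> U \<subseteq> {x \<in> topspace S. f x \<in> V}"
      unfolding neighborhood_in_def by blast
  qed
  with R show ?L by (simp add: continuous_map_def)
qed

section \<open>Step functions\<close>

lemma HM_set_funcset: "f \<in> HM_set X \<Longrightarrow> t \<in> {0..<1} \<Longrightarrow> f t \<in> topspace X"
  by (auto simp: HM_set_def)

text \<open>Each piece contributes one value, the one at its left endpoint. Finiteness lets choices
  made value by value be combined by finite intersections and unions.\<close>

lemma finite_HM_range: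
  assumes "f \<in> HM_set X"
  shows "finite (f ` {0..<1})"
proof -
  obtain n and c :: "nat \<Rightarrow> real" where
    c: "\<forall>t\<in>{0..<1}. \<exists>i<n. t \<in> {c i..<c (Suc i)}"
    "\<forall>i<n. \<forall>t\<in>{c i..<c (Suc i)}. f t = f (c i)"
    by (rule HM_set_partition[OF assms])
  have "f ` {0..<1} \<subseteq> (\<lambda>i. f (c i)) ` {..<n}"
  proof (rule image_subsetI)
    fix t :: real assume "t \<in> {0..<1}"
    with c(1) obtain i where i: "i < n" "t \<in> {c i..<c (Suc i)}" by blast
    with c(2) have "f t = f (c i)" by blast
    with i(1) show "f t \<in> (\<lambda>i. f (c i)) ` {..<n}" by blast
  qed
  then show ?thesis by (rule finite_subset) simp
qed

text \<open>
  A form of the step condition in which partitions of different functions can be merged by taking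
  unions of the sets of breakpoints.
\<close>

lemma HM_set_iff_breakpoints:
  "f \<in> HM_set X \<longleftrightarrow> f \<in> {0..<1} \<rightarrow>\<^sub>E topspace X \<and>
    (\<exists>P. finite P \<and> (\<forall>s t. 0 \<le> s \<longrightarrow> s < t \<longrightarrow> t < 1 \<longrightarrow> {s<..t} \<inter> P = {} \<longrightarrow> f s = f t))"
  (is "?L \<longleftrightarrow> ?R")
proof
  assume L: ?L
  obtain n and c :: "nat \<Rightarrow> real" where
    c: "\<forall>t\<in>{0..<1}. \<exists>i<n. t \<in> {c i..<c (Suc i)}"
    "\<forall>i<n. \<forall>t\<in>{c i..<c (Suc i)}. f t = f (c i)"
    by (rule HM_set_partition[OF L])
  \<comment> \<open>Pieces contain their left endpoint only, so a breakpoint at \<open>t\<close> can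
    separate \<open>s\<close> from \<open>t\<close> while one at \<open>s\<close> cannot; hence the
    interval open at \<open>s\<close> and closed at \<open>t\<close>. The piece of \<open>s\<close>
    then ends beyond \<open>t\<close>.\<close>
  have "f s = f t" if st: "0 \<le> s" "s < t" "t < 1" "{s<..t} \<inter> c ` {..n} = {}" for s t
  proof -
    have "s \<in> {0..<1}" using st by simp
    with c(1) obtain i where i: "i < n" "s \<in> {c i..<c (Suc i)}" by blast
    then have "c (Suc i) \<in> c ` {..n}" by auto
    with st(4) have "c (Suc i) \<notin> {s<..t}" by blast
    then have "t \<in> {c i..<c (Suc i)}" using i st by auto
    with c(2) i show ?thesis by metis
  qed
  then show ?R using L by (auto simp: HM_set_def intro!: exI[of _ "c ` {..n}"])
next
  assume R: ?R
  then obtain P where P: "finite P"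
    "\<And>s t. 0 \<le> s \<Longrightarrow> s < t \<Longrightarrow> t < 1 \<Longrightarrow> {s<..t} \<inter> P = {} \<Longrightarrow> f s = f t"
    by blast
  \<comment> \<open>Adding 0 and 1 and dropping points outside the unit interval makes the sorted
    list of breakpoints run exactly from 0 to 1.\<close>
  define Q where "Q = insert 0 (insert 1 (P \<inter> {0..1}))"
  define xs where "xs = sorted_list_of_set Q"
  define n where "n = length xs - 1"
  have Q: "finite Q" "Q \<subseteq> {0..1}" "0 \<in> Q" "1 \<in> Q" using P(1) by (auto simp: Q_def)
  have xs: "sorted_wrt (<) xs" "set xs = Q" using Q(1) by (simp_all add: xs_def)
  have "xs \<noteq> []" using xs(2) Q(3) by auto
  then have len: "length xs = Suc n" by (simp add: n_def)
  have less: "xs ! i < xs ! j" if "i < j" "j \<le> n" for i j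
    using xs(1) that len by (simp add: sorted_wrt_iff_nth_less)
  have mem: "xs ! i \<in> Q" if "i \<le> n" for i using that len xs(2) nth_mem[of i xs] by simp
  have ex: "\<exists>i\<le>n. xs ! i = q" if "q \<in> Q" for q
    using that len xs(2) by (metis in_set_conv_nth less_Suc_eq_le)
  have first: "xs ! 0 = 0"
  proof -
    obtain i where i: "i \<le> n" "xs ! i = 0" using ex[OF Q(3)] by blast
    with less[of 0 i] mem[of 0] Q(2) show ?thesis by (cases "i = 0") force+
  qed
  have last: "xs ! n = 1"
  proof -
    obtain i where i: "i \<le> n" "xs ! i = 1" using ex[OF Q(4)] by blast
    with less[of i n] mem[of n] Q(2) show ?thesis by (cases "i = n") force+
  qed
  have const: "f constant_on {xs ! i..<xs ! Suc i}" if i: "i < n" for i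
  proof -
    have "f t = f (xs ! i)" if t: "t \<in> {xs ! i..<xs ! Suc i}" for t
    proof (cases "t = xs ! i")
      case False
      have bds: "0 \<le> xs ! i" "xs ! Suc i \<le> 1" using mem[of i] mem[of "Suc i"] Q(2) i by auto
      \<comment> \<open>A breakpoint here would be an entry of \<open>xs\<close> strictly between
        two consecutive entries.\<close>
      have "{xs ! i<..t} \<inter> P = {}"
      proof (rule ccontr)
        assume "{xs ! i<..t} \<inter> P \<noteq> {}"
        then obtain p where p: "xs ! i < p" "p \<le> t" "p \<in> P" by auto
        then have "p \<in> Q" using bds t by (auto simp: Q_def)
        then obtain j where j: "j \<le> n" "xs ! j = p" using ex by blast
        have "i < j" using less[of j i] i j p(1) by (cases i j rule: linorder_cases) auto
        moreover have "j < Suc i" using less[of "Suc i" j] j p(2) t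
          by (cases j "Suc i" rule: linorder_cases) auto
        ultimately show False by simp
      qed
      with P(2)[of "xs ! i" t] bds t False show ?thesis by simp
    qed simp
    then show ?thesis unfolding constant_on_def by blast
  qed
  show ?L unfolding HM_set_def
    using R first last less const
    by (auto intro!: exI[of _ n] exI[of _ "\<lambda>i. xs ! i"])
qed

lemma HM_map_apply: "t \<in> {0..<1} \<Longrightarrow> HM_map u f t = u (f t)"
  by (simp add: HM_map_def)

lemma HM_mult_apply: "t \<in> {0..<1} \<Longrightarrow> HM_mult m f g t = m (f t) (g t)"
  by (simp add: HM_mult_def)

text \<open>The union of breakpoint sets of the factors serves the product: an interval that avoids
  the union leaves both factors unchanged.\<close>

lemma HM_mult_in_HM_set:
  assumes "f \<in> HM_set X" "g \<in> HM_set X"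
    and m: "\<And>x y. x \<in> topspace X \<Longrightarrow> y \<in> topspace X \<Longrightarrow> m x y \<in> topspace X"
  shows "HM_mult m f g \<in> HM_set X"
proof -
  obtain P where P: "finite P"
    "\<And>s t. 0 \<le> s \<Longrightarrow> s < t \<Longrightarrow> t < 1 \<Longrightarrow> {s<..t} \<inter> P = {} \<Longrightarrow> f s = f t"
    using assms(1) unfolding HM_set_iff_breakpoints by blast
  obtain Q where Q: "finite Q"
    "\<And>s t. 0 \<le> s \<Longrightarrow> s < t \<Longrightarrow> t < 1 \<Longrightarrow> {s<..t} \<inter> Q = {} \<Longrightarrow> g s = g t"
    using assms(2) unfolding HM_set_iff_breakpoints by blast
  have "HM_mult m f g \<in> {0..<1} \<rightarrow>\<^sub>E topspace X"
    using HM_set_funcset[OF assms(1)] HM_set_funcset[OF assms(2)] m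
    by (auto simp: HM_mult_def)
  moreover have "HM_mult m f g s = HM_mult m f g t"
    if "0 \<le> s" "s < t" "t < 1" "{s<..t} \<inter> (P \<union> Q) = {}" for s t
  proof -
    have "{s<..t} \<inter> P = {}" "{s<..t} \<inter> Q = {}" using that(4) by blast+
    with P(2)[of s t] Q(2)[of s t] that(1-3) show ?thesis by (simp add: HM_mult_apply)
  qed
  ultimately show ?thesis
    unfolding HM_set_iff_breakpoints using P(1) Q(1)
    by (intro conjI exI[of _ "P \<union> Q"]) auto
qed

lemma HM_map_in_HM_set:
  assumes "f \<in> HM_set X" "u \<in> topspace X \<rightarrow> topspace X"
  shows "HM_map u f \<in> HM_set X"
proof -
  \<comment> \<open>Composition with \<open>u\<close> is the pointwise product for an operation that
    ignores its second argument.\<close>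
  have "HM_map u f = HM_mult (\<lambda>x y. u x) f f" by (simp add: HM_map_def HM_mult_def)
  with HM_mult_in_HM_set[OF assms(1) assms(1), of "\<lambda>x y. u x"] assms(2) show ?thesis by auto
qed

section \<open>A neighborhood base of the Hartman--Mycielski topology\<close>

text \<open>An exceptional set. The neighborhood is indexed by the value \<open>f t\<close> and not
  by \<open>t\<close>, so that only finitely many sets \<open>V x\<close> matter for a step function
  \<open>f\<close>.\<close>

definition HM_dev :: "(real \<Rightarrow> 'a) \<Rightarrow> ('a \<Rightarrow> 'a set) \<Rightarrow> (real \<Rightarrow> 'a) \<Rightarrow> real set" where
  "HM_dev f V g = {t \<in> {0..<1}. g t \<notin> V (f t)}"

definition HM_close :: "'a topology \<Rightarrow> (real \<Rightarrow> 'a) \<Rightarrow> ('a \<Rightarrow> 'a set) \<Rightarrow> real \<Rightarrow> (real \<Rightarrow> 'a) set" where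
  "HM_close X f V \<epsilon> = {g \<in> HM_set X. measure lebesgue (HM_dev f V g) < \<epsilon>}"

lemma HM_dev_lmeasurable:
  assumes "f \<in> HM_set X" "g \<in> HM_set X"
  shows "HM_dev f V g \<in> lmeasurable"
proof -
  \<comment> \<open>Split by the value \<open>x\<close> of \<open>f\<close>. Removing the points
    with \<open>f t \<notin> {x}\<close> leaves those with \<open>f t = x\<close>, and both sets in
    the difference have the form already known to be measurable.\<close>
  have "HM_dev f V g = (\<Union>x\<in>f ` {0..<1}.
    {t \<in> {0..<1}. g t \<notin> V x} - {t \<in> {0..<1}. f t \<notin> {x}})"
    unfolding HM_dev_def by auto
  also have "\<dots> \<in> lmeasurable"
    using finite_HM_range[OF assms(1)] assms
    by (intro fmeasurable.finite_UN fmeasurable.Diff HM_bad_set_lmeasurable) auto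
  finally show ?thesis .
qed

text \<open>Subadditivity in the form used when one exceptional set is covered by others: two for
  products, three for dicontinuity.\<close>

lemma measure_lebesgue_cover2:
  assumes "S \<in> lmeasurable" "A \<in> lmeasurable" "B \<in> lmeasurable" "S \<subseteq> A \<union> B"
  shows "measure lebesgue S \<le> measure lebesgue A + measure lebesgue B"
proof -
  have "measure lebesgue S \<le> measure lebesgue (A \<union> B)"
    using assms by (intro measure_mono_fmeasurable) (auto intro: fmeasurableD)
  also have "\<dots> \<le> measure lebesgue A + measure lebesgue B"
    using assms by (intro measure_Un_le) (auto intro: fmeasurableD)
  finally show ?thesis .
qed

lemma measure_lebesgue_cover3:
  assumes "S \<in> lmeasurable" "A \<in> lmeasurable" "B \<in> lmeasurable" "C \<in> lmeasurable"
    "S \<subseteq> A \<union> B \<union> C"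
  shows "measure lebesgue S \<le> measure lebesgue A + measure lebesgue B + measure lebesgue C"
  using measure_lebesgue_cover2[of S "A \<union> B" C] measure_lebesgue_cover2[of "A \<union> B" A B] assms
  by (simp add: fmeasurable.Un)

lemma HM_close_mono:
  assumes "f \<in> HM_set X" "\<epsilon> \<le> \<epsilon>'" "\<And>x. x \<in> f ` {0..<1} \<Longrightarrow> V x \<subseteq> V' x"
  shows "HM_close X f V \<epsilon> \<subseteq> HM_close X f V' \<epsilon>'"
proof
  fix g assume g: "g \<in> HM_close X f V \<epsilon>"
  then have gH: "g \<in> HM_set X" by (simp add: HM_close_def)
  have "HM_dev f V' g \<subseteq> HM_dev f V g" using assms(3) by (fastforce simp: HM_dev_def)
  then have "measure lebesgue (HM_dev f V' g) \<le> measure lebesgue (HM_dev f V g)"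
    using HM_dev_lmeasurable[OF assms(1) gH]
    by (intro measure_mono_fmeasurable) (auto intro: fmeasurableD)
  with g assms(2) show "g \<in> HM_close X f V' \<epsilon>'" by (simp add: HM_close_def)
qed

text \<open>Each of the at most \<open>n\<close> pieces of \<open>f\<close> gets a sub-basic
  condition with tolerance \<open>\<epsilon> / n\<close>; the exceptional sets on the pieces cover
  the whole exceptional set.\<close>

lemma neighborhood_in_HM_close:
  assumes f: "f \<in> HM_set X" and \<epsilon>: "\<epsilon> > 0"
    and V: "\<And>x. x \<in> f ` {0..<1} \<Longrightarrow> neighborhood_in X x (V x)"
  shows "neighborhood_in (HM_topology X) f (HM_close X f V \<epsilon>)"
proof -
  obtain n and c :: "nat \<Rightarrow> real" where
    c: "c 0 = 0" "c n = 1" "\<forall>t\<in>{0..<1}. \<exists>i<n. t \<in> {c i..<c (Suc i)}"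
    "\<forall>i<n. \<forall>t\<in>{c i..<c (Suc i)}. f t = f (c i)" "\<forall>i<n. c i \<in> {0..<1}"
    by (rule HM_set_partition[OF f])
  \<comment> \<open>Sub-basic sets require nondegenerate intervals, which the facts obtained about
    \<open>c\<close> do not guarantee. Any piece that contains a point is nondegenerate, so no point
    is lost.\<close>
  define I where "I = {i. i < n \<and> c i < c (Suc i)}"
  have "n > 0" using c(1,2) by (cases n) auto
  have "finite I" "card I \<le> n" using card_mono[of "{..<n}" I] by (auto simp: I_def)
  have le1: "c (Suc i) \<le> 1" if "i < n" for i
    using c(2,5) that by (cases "Suc i = n") (auto simp: less_le)
  define N where "N i = HM_nbhd X (c i) (c (Suc i)) (V (f (c i))) (\<epsilon> / n)" for i
  have "N i \<in> HM_subbase X f" if "i \<in> I" for i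
  proof -
    have i: "i < n" "c i < c (Suc i)" using that by (auto simp: I_def)
    have "f constant_on {c i..<c (Suc i)}" using c(4) i unfolding constant_on_def by blast
    moreover have "neighborhood_in X (f (c i)) (V (f (c i)))" using c(5) i V by blast
    ultimately show ?thesis
      unfolding HM_subbase_def N_def mem_Collect_eq using i le1[OF i(1)] c(5) \<epsilon> \<open>n > 0\<close>
      by (intro exI[of _ "c i"] exI[of _ "c (Suc i)"] exI[of _ "V (f (c i))"] exI[of _ "\<epsilon> / n"]
        conjI refl) simp_all
  qed
  moreover have "HM_set X \<inter> \<Inter>(N ` I) \<subseteq> HM_close X f V \<epsilon>"
  proof
    fix g assume "g \<in> HM_set X \<inter> \<Inter>(N ` I)"
    then have g: "g \<in> HM_set X" "\<And>i. i \<in> I \<Longrightarrow> g \<in> N i" by auto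
    define D where "D i = {t \<in> {c i..<c (Suc i)}. g t \<notin> V (f (c i))}" for i
    have mD: "D i \<in> lmeasurable" if "i \<in> I" for i
      unfolding D_def using g(1) that c(5) le1
      by (intro HM_bad_set_lmeasurable) (auto simp: I_def)
    have less: "measure lebesgue (D i) < \<epsilon> / n" if "i \<in> I" for i
      using g(2)[OF that] by (simp add: N_def HM_nbhd_def D_def)
    have "HM_dev f V g \<subseteq> (\<Union>i\<in>I. D i)"
    proof
      fix t assume t: "t \<in> HM_dev f V g"
      then obtain i where i: "i < n" "t \<in> {c i..<c (Suc i)}"
        using c(3) unfolding HM_dev_def by blast
      moreover have "f t = f (c i)" using c(4) i by blast
      ultimately show "t \<in> (\<Union>i\<in>I. D i)" using t by (auto simp: I_def D_def HM_dev_def)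
    qed
    then have "measure lebesgue (HM_dev f V g) \<le> measure lebesgue (\<Union>i\<in>I. D i)"
      using HM_dev_lmeasurable[OF f g(1)] mD \<open>finite I\<close>
      by (intro measure_mono_fmeasurable fmeasurable.finite_UN) (auto intro: fmeasurableD)
    also have "\<dots> \<le> (\<Sum>i\<in>I. measure lebesgue (D i))"
      using \<open>finite I\<close> mD by (intro measure_UNION_le) (auto intro: fmeasurableD)
    also have "\<dots> < \<epsilon>"
    \<comment> \<open>Termwise strict inequalities give a strict inequality of sums only over a
      nonempty index set.\<close>
    proof (cases "I = {}")
      case False
      then have "(\<Sum>i\<in>I. measure lebesgue (D i)) < (\<Sum>i\<in>I. \<epsilon> / n)"
        using \<open>finite I\<close> less by (intro sum_strict_mono) auto
      also have "\<dots> \<le> n * (\<epsilon> / n)"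
        using mult_right_mono[of "real (card I)" n "\<epsilon> / n"] \<open>card I \<le> n\<close> \<epsilon> by simp
      finally show ?thesis using \<open>n > 0\<close> by simp
    qed (use \<epsilon> in simp)
    finally show "g \<in> HM_close X f V \<epsilon>" using g(1) by (simp add: HM_close_def)
  qed
  ultimately show ?thesis
    unfolding neighborhood_in_HM_iff[OF f] using \<open>finite I\<close>
    by (intro conjI exI[of _ "N ` I"]) (auto simp: HM_close_def)
qed

text \<open>Induction over the finitely many sub-basic sets: each one restricts \<open>g\<close>
  near a single value of \<open>f\<close>, so it is absorbed by shrinking one neighborhood and the
  tolerance.\<close>

lemma neighborhood_in_HM_imp_HM_close:
  assumes f: "f \<in> HM_set X" and N: "neighborhood_in (HM_topology X) f N"
  obtains V \<epsilon> where "\<epsilon> > 0" "\<And>x. x \<in> f ` {0..<1} \<Longrightarrow> neighborhood_in X x (V x)"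
    "HM_close X f V \<epsilon> \<subseteq> N"
proof -
  from N obtain F where F: "finite F" "F \<subseteq> HM_subbase X f" "HM_set X \<inter> \<Inter>F \<subseteq> N"
    unfolding neighborhood_in_HM_iff[OF f] by blast
  from F(1,2) have "\<exists>V. \<exists>\<epsilon>>0. (\<forall>x\<in>f ` {0..<1}. neighborhood_in X x (V x)) \<and>
    HM_close X f V \<epsilon> \<subseteq> HM_set X \<inter> \<Inter>F"
  proof (induction F)
    case empty
    then show ?case using f
      by (intro exI[of _ "\<lambda>_. topspace X"] exI[of _ 1])
        (auto simp: HM_close_def intro: neighborhood_in_topspace HM_set_funcset)
  next
    case (insert M F)
    then obtain V \<epsilon> where V: "\<epsilon> > 0" "\<forall>x\<in>f ` {0..<1}. neighborhood_in X x (V x)"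
      "HM_close X f V \<epsilon> \<subseteq> HM_set X \<inter> \<Inter>F" by auto
    from insert.prems obtain a b W \<delta> where M: "M = HM_nbhd X a b W \<delta>" "0 \<le> a" "a < b" "b \<le> 1"
      "f constant_on {a..<b}" "neighborhood_in X (f a) W" "\<delta> > 0"
      unfolding HM_subbase_def by blast
    \<comment> \<open>\<open>f\<close> has the value \<open>f a\<close> on all of the interval, so
      \<open>W\<close> is needed at this value only. It is then imposed wherever \<open>f\<close>
      takes the value, possibly beyond the interval, which only strengthens the condition.\<close>
    define V' where "V' x = V x \<inter> (if x = f a then W else topspace X)" for x
    have "neighborhood_in X x (V' x)" if "x \<in> f ` {0..<1}" for x
      unfolding V'_def using V(2) M(6) that f
      by (intro neighborhood_in_Int) (auto intro: neighborhood_in_topspace HM_set_funcset)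
    moreover have "HM_close X f V' (min \<epsilon> \<delta>) \<subseteq> HM_close X f V \<epsilon>"
      using f by (rule HM_close_mono) (auto simp: V'_def)
    moreover have "HM_close X f V' (min \<epsilon> \<delta>) \<subseteq> M"
    proof
      fix g assume g: "g \<in> HM_close X f V' (min \<epsilon> \<delta>)"
      then have gH: "g \<in> HM_set X" by (simp add: HM_close_def)
      have "{t \<in> {a..<b}. g t \<notin> W} \<subseteq> HM_dev f V' g"
      proof
        fix t assume t: "t \<in> {t \<in> {a..<b}. g t \<notin> W}"
        then have "f t = f a" using M(3,5) unfolding constant_on_def by force
        with t M(2,4) show "t \<in> HM_dev f V' g" by (simp add: HM_dev_def V'_def)
      qed
      then have "measure lebesgue {t \<in> {a..<b}. g t \<notin> W} \<le> measure lebesgue (HM_dev f V' g)"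
        using HM_dev_lmeasurable[OF f gH] HM_bad_set_lmeasurable[OF gH M(2,4)]
        by (intro measure_mono_fmeasurable) (auto intro: fmeasurableD)
      with g show "g \<in> M" by (simp add: M(1) HM_nbhd_def HM_close_def)
    qed
    ultimately show ?case using V(1,3) M(7)
      by (intro exI[of _ V'] exI[of _ "min \<epsilon> \<delta>"]) auto
  qed
  with F(3) that show thesis by (meson subset_trans)
qed

section \<open>The operations on the Hartman--Mycielski extension\<close>

lemma topological_semigroup_closed:
  assumes "topological_semigroup X m" "x \<in> topspace X" "y \<in> topspace X"
  shows "m x y \<in> topspace X"
proof -
  have "(\<lambda>(x, y). m x y) \<in> topspace (prod_topology X X) \<rightarrow> topspace X"
    using assms(1) unfolding topological_semigroup_def by (blast dest: continuous_map_funspace)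
  moreover have "(x, y) \<in> topspace (prod_topology X X)" using assms(2,3) by simp
  ultimately have "(\<lambda>(x, y). m x y) (x, y) \<in> topspace X" by (rule funcset_mem)
  then show ?thesis by simp
qed

text \<open>Continuity of \<open>m\<close> at each pair \<open>(f t, g t)\<close> gives
  neighborhoods of the two values. A time is exceptional for the product only if it is so for one of
  the factors, whence the tolerance \<open>\<epsilon>/2\<close> for each.\<close>

lemma continuous_map_HM_mult:
  assumes X: "topological_semigroup X m"
  shows "continuous_map (prod_topology (HM_topology X) (HM_topology X)) (HM_topology X)
    (\<lambda>(f, g). HM_mult m f g)"
proof -
  have m: "continuous_map (prod_topology X X) X (\<lambda>(x, y). m x y)"
    using X by (simp add: topological_semigroup_def)
  have closed: "HM_mult m f g \<in> HM_set X" if "f \<in> HM_set X" "g \<in> HM_set X" for f g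
    using that topological_semigroup_closed[OF X] by (rule HM_mult_in_HM_set)
  have "\<exists>N. neighborhood_in (prod_topology (HM_topology X) (HM_topology X)) (f, g) N \<and>
      (\<lambda>(f, g). HM_mult m f g) ` N \<subseteq> Z"
    if f: "f \<in> HM_set X" and g: "g \<in> HM_set X"
      and Z: "neighborhood_in (HM_topology X) (HM_mult m f g) Z" for f g Z
  proof -
    obtain W \<epsilon> where W: "\<epsilon> > 0"
      "\<And>z. z \<in> HM_mult m f g ` {0..<1} \<Longrightarrow> neighborhood_in X z (W z)"
      "HM_close X (HM_mult m f g) W \<epsilon> \<subseteq> Z"
      by (rule neighborhood_in_HM_imp_HM_close[OF closed[OF f g] Z]) (rule that)
    define R where "R = (\<lambda>t. (f t, g t)) ` {0..<1}"
    have "\<exists>U V. neighborhood_in X x U \<and> neighborhood_in X y V \<and> (\<forall>x'\<in>U. \<forall>y'\<in>V. m x' y' \<in> W (m x y))"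
      if xy: "(x, y) \<in> R" for x y
    proof -
      from xy obtain t where t: "t \<in> {0..<1}" "x = f t" "y = g t" unfolding R_def by blast
      have "m x y \<in> HM_mult m f g ` {0..<1}"
        using t by (metis HM_mult_apply imageI)
      then have "neighborhood_in X (m x y) (W (m x y))" by (rule W(2))
      moreover have "(x, y) \<in> topspace (prod_topology X X)"
        using t HM_set_funcset[OF f] HM_set_funcset[OF g] by simp
      ultimately obtain N where N: "neighborhood_in (prod_topology X X) (x, y) N"
        "(\<lambda>(x, y). m x y) ` N \<subseteq> W (m x y)"
        using m unfolding continuous_map_iff_neighborhood_in by fastforce
      then obtain U V where UV: "neighborhood_in X x U" "neighborhood_in X y V" "U \<times> V \<subseteq> N"
        unfolding neighborhood_in_prod_topology by blast
      have "\<forall>x'\<in>U. \<forall>y'\<in>V. m x' y' \<in> W (m x y)" using N(2) UV(3) by fastforce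
      with UV(1,2) show ?thesis by blast
    qed
    then obtain U V where UV: "\<And>x y. (x, y) \<in> R \<Longrightarrow> neighborhood_in X x (U x y)"
      "\<And>x y. (x, y) \<in> R \<Longrightarrow> neighborhood_in X y (V x y)"
      "\<And>x y. (x, y) \<in> R \<Longrightarrow> \<forall>x'\<in>U x y. \<forall>y'\<in>V x y. m x' y' \<in> W (m x y)"
      by metis
    have finR: "finite {y. (x, y) \<in> R}" "finite {x. (x, y) \<in> R}" for x y
      by (rule finite_subset[OF _ finite_HM_range[OF g]], force simp: R_def)
        (rule finite_subset[OF _ finite_HM_range[OF f]], force simp: R_def)
    \<comment> \<open>\<open>U x y\<close> depends on a pair of values, but a basic neighborhood of
      \<open>f\<close> may depend on \<open>x\<close> only. The intersection runs over the values
      \<open>y\<close> that \<open>g\<close> takes together with \<open>x\<close>, finitely many by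
      \<open>finR\<close>.\<close>
    define U' where "U' x = topspace X \<inter> (\<Inter>y\<in>{y. (x, y) \<in> R}. U x y)" for x
    define V' where "V' y = topspace X \<inter> (\<Inter>x\<in>{x. (x, y) \<in> R}. V x y)" for y
    have U': "neighborhood_in X x (U' x)" if "x \<in> f ` {0..<1}" for x
      unfolding U'_def using that UV(1) HM_set_funcset[OF f] finR(1)
      by (intro neighborhood_in_finite_INT) auto
    have V': "neighborhood_in X y (V' y)" if "y \<in> g ` {0..<1}" for y
      unfolding V'_def using that UV(2) HM_set_funcset[OF g] finR(2)
      by (intro neighborhood_in_finite_INT) auto
    have "HM_mult m f' g' \<in> HM_close X (HM_mult m f g) W \<epsilon>"
      if f': "f' \<in> HM_close X f U' (\<epsilon>/2)" and g': "g' \<in> HM_close X g V' (\<epsilon>/2)" for f' g'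
    proof -
      have H: "f' \<in> HM_set X" "g' \<in> HM_set X" using f' g' by (auto simp: HM_close_def)
      have "HM_dev (HM_mult m f g) W (HM_mult m f' g') \<subseteq> HM_dev f U' f' \<union> HM_dev g V' g'"
      proof
        fix t assume t: "t \<in> HM_dev (HM_mult m f g) W (HM_mult m f' g')"
        then have t': "t \<in> {0..<1}" "m (f' t) (g' t) \<notin> W (m (f t) (g t))"
          by (auto simp: HM_dev_def HM_mult_apply)
        moreover have "(f t, g t) \<in> R" using t'(1) by (simp add: R_def)
        ultimately have "f' t \<notin> U' (f t) \<or> g' t \<notin> V' (g t)"
          using UV(3)[of "f t" "g t"] unfolding U'_def V'_def by blast
        with t'(1) show "t \<in> HM_dev f U' f' \<union> HM_dev g V' g'" by (auto simp: HM_dev_def)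
      qed
      then have "measure lebesgue (HM_dev (HM_mult m f g) W (HM_mult m f' g')) \<le>
        measure lebesgue (HM_dev f U' f') + measure lebesgue (HM_dev g V' g')"
        using f g H closed by (intro measure_lebesgue_cover2 HM_dev_lmeasurable)
      also have "\<dots> < \<epsilon>" using f' g' by (simp add: HM_close_def)
      finally show ?thesis using closed H by (simp add: HM_close_def)
    qed
    then have "(\<lambda>(f, g). HM_mult m f g) ` (HM_close X f U' (\<epsilon>/2) \<times> HM_close X g V' (\<epsilon>/2)) \<subseteq> Z"
      using W(3) by auto
    moreover have "neighborhood_in (prod_topology (HM_topology X) (HM_topology X)) (f, g)
      (HM_close X f U' (\<epsilon>/2) \<times> HM_close X g V' (\<epsilon>/2))"
      unfolding neighborhood_in_prod_topology
      using neighborhood_in_HM_close[OF f _ U', of "\<epsilon>/2"] neighborhood_in_HM_close[OF g _ V', of "\<epsilon>/2"]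
        W(1) by (auto simp: HM_close_def intro!: exI)
    ultimately show ?thesis by blast
  qed
  with closed show ?thesis unfolding continuous_map_iff_neighborhood_in by auto
qed

text \<open>Constant functions give nonemptiness, and associativity is inherited pointwise.\<close>

lemma topological_semigroup_HM:
  assumes X: "topological_semigroup X m"
  shows "topological_semigroup (HM_topology X) (HM_mult m)"
  unfolding topological_semigroup_def
proof (intro conjI continuous_map_HM_mult[OF X] ballI)
  obtain x where "x \<in> topspace X" using X unfolding topological_semigroup_def by blast
  then have "(\<lambda>t\<in>{0..<1}. x) \<in> HM_set X"
    unfolding HM_set_iff_breakpoints by (auto intro!: exI[of _ "{}"])
  then show "topspace (HM_topology X) \<noteq> {}" by auto
next
  fix f g h assume "f \<in> topspace (HM_topology X)" "g \<in> topspace (HM_topology X)"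
    "h \<in> topspace (HM_topology X)"
  then have "m (m (f t) (g t)) (h t) = m (f t) (m (g t) (h t))" if "t \<in> {0..<1}" for t
    using X that unfolding topological_semigroup_def by (simp add: HM_set_funcset)
  then show "HM_mult m (HM_mult m f g) h = HM_mult m f (HM_mult m g h)"
    unfolding HM_mult_def by (auto intro!: restrict_ext)
qed

text \<open>With neighborhoods chosen by continuity of \<open>u\<close> at the values of
  \<open>f\<close>, composing with \<open>u\<close> creates no new exceptional times, so the
  tolerance is kept.\<close>

lemma continuous_map_HM_map:
  assumes u: "continuous_map X X u"
  shows "continuous_map (HM_topology X) (HM_topology X) (HM_map u)"
proof -
  have closed: "HM_map u f \<in> HM_set X" if "f \<in> HM_set X" for f
    using that continuous_map_funspace[OF u] by (rule HM_map_in_HM_set)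
  have "\<exists>N. neighborhood_in (HM_topology X) f N \<and> HM_map u ` N \<subseteq> Z"
    if f: "f \<in> HM_set X" and Z: "neighborhood_in (HM_topology X) (HM_map u f) Z" for f Z
  proof -
    obtain W \<epsilon> where W: "\<epsilon> > 0"
      "\<And>z. z \<in> HM_map u f ` {0..<1} \<Longrightarrow> neighborhood_in X z (W z)"
      "HM_close X (HM_map u f) W \<epsilon> \<subseteq> Z"
      by (rule neighborhood_in_HM_imp_HM_close[OF closed[OF f] Z]) (rule that)
    have "\<exists>U. neighborhood_in X x U \<and> u ` U \<subseteq> W (u x)" if "x \<in> f ` {0..<1}" for x
    proof -
      have "u x \<in> HM_map u f ` {0..<1}" using that by (force simp: HM_map_apply)
      moreover have "x \<in> topspace X" using that HM_set_funcset[OF f] by blast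
      ultimately show ?thesis
        using u W(2) unfolding continuous_map_iff_neighborhood_in by blast
    qed
    then obtain U where U: "\<And>x. x \<in> f ` {0..<1} \<Longrightarrow> neighborhood_in X x (U x)"
      "\<And>x. x \<in> f ` {0..<1} \<Longrightarrow> u ` U x \<subseteq> W (u x)" by metis
    have "HM_map u g \<in> HM_close X (HM_map u f) W \<epsilon>" if g: "g \<in> HM_close X f U \<epsilon>" for g
    proof -
      have H: "g \<in> HM_set X" using g by (simp add: HM_close_def)
      have "HM_dev (HM_map u f) W (HM_map u g) \<subseteq> HM_dev f U g"
        using U(2) by (fastforce simp: HM_dev_def HM_map_apply)
      then have "measure lebesgue (HM_dev (HM_map u f) W (HM_map u g)) \<le>
        measure lebesgue (HM_dev f U g)"
        using HM_dev_lmeasurable[OF f H] HM_dev_lmeasurable[OF closed[OF f] closed[OF H]]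
        by (intro measure_mono_fmeasurable) (auto intro: fmeasurableD)
      with g closed[OF H] show ?thesis by (simp add: HM_close_def)
    qed
    then have "HM_map u ` HM_close X f U \<epsilon> \<subseteq> Z" using W(3) by blast
    with neighborhood_in_HM_close[OF f W(1) U(1)] show ?thesis by blast
  qed
  with closed show ?thesis unfolding continuous_map_iff_neighborhood_in by simp
qed

text \<open>Dicontinuity of \<open>l\<close> at the value \<open>f t\<close> places
  \<open>g t\<close> in the prescribed neighborhood unless one of three conditions fails at
  \<open>t\<close>: on \<open>a t\<close>, on \<open>m (a t) (g t)\<close>, or on
  \<open>l (g t)\<close>.\<close>

lemma dicontinuous_left_unit_operation_HM:
  assumes l: "dicontinuous_left_unit_operation X m l"
    and m: "\<And>x y. x \<in> topspace X \<Longrightarrow> y \<in> topspace X \<Longrightarrow> m x y \<in> topspace X"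
  shows "dicontinuous_left_unit_operation (HM_topology X) (HM_mult m) (HM_map l)"
proof -
  have lX: "l \<in> topspace X \<rightarrow> topspace X" and unit: "\<And>x. x \<in> topspace X \<Longrightarrow> m (l x) x = x"
    and cont: "continuous_map X X l"
    using l by (auto simp: dicontinuous_left_unit_operation_def left_unit_operation_def)
  \<comment> \<open>Here \<open>W\<close> is a neighborhood in \<open>X\<close>, as basic
    neighborhoods of \<open>HM_map l f\<close> require; membership of \<open>a\<close> in the image
    of \<open>l\<close> becomes a separate condition.\<close>
  have dicont: "\<exists>U W. neighborhood_in X x U \<and> neighborhood_in X (l x) W \<and>
      (\<forall>a\<in>W \<inter> l ` topspace X. \<forall>y\<in>topspace X. m a y \<in> U \<longrightarrow> l y \<in> W \<longrightarrow> y \<in> V)"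
    if x: "x \<in> topspace X" and V: "neighborhood_in X x V" for x V
  proof -
    from l x V obtain U W where UW: "neighborhood_in X x U"
      "neighborhood_in (subtopology X (l ` topspace X)) (l x) W"
      "left_quot X m W U \<inter> {y \<in> topspace X. l y \<in> W} \<subseteq> V"
      unfolding dicontinuous_left_unit_operation_def by meson
    from UW(2) obtain W' where W': "neighborhood_in X (l x) W'" "W' \<inter> l ` topspace X \<subseteq> W"
      using x lX by (subst (asm) neighborhood_in_subtopology) auto
    have "y \<in> V" if "a \<in> W' \<inter> l ` topspace X" "y \<in> topspace X" "m a y \<in> U" "l y \<in> W'" for a y
    proof -
      have "a \<in> W" "l y \<in> W" using that W'(2) by auto
      with that(2,3) have "y \<in> left_quot X m W U \<inter> {y \<in> topspace X. l y \<in> W}"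
        unfolding left_quot_def by blast
      with UW(3) show ?thesis by blast
    qed
    with UW(1) W'(1) show ?thesis by blast
  qed
  have lH: "HM_map l f \<in> HM_set X" if "f \<in> HM_set X" for f
    using that lX by (rule HM_map_in_HM_set)
  have mH: "HM_mult m f g \<in> HM_set X" if "f \<in> HM_set X" "g \<in> HM_set X" for f g
    using that m by (rule HM_mult_in_HM_set)
  have unitH: "HM_mult m (HM_map l f) f = f" if f: "f \<in> HM_set X" for f
  proof
    fix t show "HM_mult m (HM_map l f) f t = f t"
    proof (cases "t \<in> {0..<1}")
      case True
      then show ?thesis using HM_set_funcset[OF f] by (simp add: HM_mult_apply HM_map_apply unit)
    next
      \<comment> \<open>Outside the domain both sides are \<open>undefined\<close>, which makes the
        equality one of total functions.\<close>
      case False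
      moreover have "f t = undefined"
        using f False by (auto simp: HM_set_def PiE_def extensional_def)
      ultimately show ?thesis by (simp only: HM_mult_def restrict_def if_False)
    qed
  qed
  have dicontH: "\<exists>U W. neighborhood_in (HM_topology X) f U \<and>
      neighborhood_in (subtopology (HM_topology X) (HM_map l ` HM_set X)) (HM_map l f) W \<and>
      left_quot (HM_topology X) (HM_mult m) W U \<inter> {g \<in> HM_set X. HM_map l g \<in> W} \<subseteq> Z"
    if f: "f \<in> HM_set X" and Z: "neighborhood_in (HM_topology X) f Z" for f Z
  proof -
    obtain V \<epsilon> where V: "\<epsilon> > 0" "\<And>x. x \<in> f ` {0..<1} \<Longrightarrow> neighborhood_in X x (V x)"
      "HM_close X f V \<epsilon> \<subseteq> Z"
      by (rule neighborhood_in_HM_imp_HM_close[OF f Z]) (rule that)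
    have fX: "x \<in> topspace X" if "x \<in> f ` {0..<1}" for x using that HM_set_funcset[OF f] by blast
    have "\<exists>U W. neighborhood_in X x U \<and> neighborhood_in X (l x) W \<and>
      (\<forall>a\<in>W \<inter> l ` topspace X. \<forall>y\<in>topspace X. m a y \<in> U \<longrightarrow> l y \<in> W \<longrightarrow> y \<in> V x)"
      if "x \<in> f ` {0..<1}" for x
      using dicont fX V(2) that by blast
    then obtain U W where UW: "\<And>x. x \<in> f ` {0..<1} \<Longrightarrow> neighborhood_in X x (U x)"
      "\<And>x. x \<in> f ` {0..<1} \<Longrightarrow> neighborhood_in X (l x) (W x)"
      "\<And>x a y. x \<in> f ` {0..<1} \<Longrightarrow> a \<in> W x \<Longrightarrow> a \<in> l ` topspace X \<Longrightarrow> y \<in> topspace X \<Longrightarrow>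
        m a y \<in> U x \<Longrightarrow> l y \<in> W x \<Longrightarrow> y \<in> V x"
      by (metis IntI)
    \<comment> \<open>\<open>W\<close> depends on a value \<open>x\<close> of \<open>f\<close>, but a neighborhood of \<open>HM_map l f\<close> may only depend on \<open>l x\<close>.\<close>
    define W' where "W' z = topspace X \<inter> (\<Inter>x\<in>{x \<in> f ` {0..<1}. l x = z}. W x)" for z
    have W': "neighborhood_in X z (W' z)" if "z \<in> HM_map l f ` {0..<1}" for z
      unfolding W'_def
    proof (rule neighborhood_in_finite_INT)
      show "finite {x \<in> f ` {0..<1}. l x = z}" using finite_HM_range[OF f] by simp
      show "z \<in> topspace X" using that HM_set_funcset[OF lH[OF f]] by blast
    qed (use UW(2) in blast)
    \<comment> \<open>Three exceptional sets will cover the one for \<open>g\<close>: one controlled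
      by \<open>UU\<close> and two by \<open>WW\<close>, each of measure below
      \<open>\<epsilon>/3\<close>.\<close>
    define UU where "UU = HM_close X f U (\<epsilon>/3)"
    define WW where "WW = HM_close X (HM_map l f) W' (\<epsilon>/3)"
    have UU: "neighborhood_in (HM_topology X) f UU"
      unfolding UU_def using V(1) by (intro neighborhood_in_HM_close f UW(1)) auto
    have "neighborhood_in (HM_topology X) (HM_map l f) WW"
      unfolding WW_def using V(1) by (intro neighborhood_in_HM_close lH f W') auto
    then have WW: "neighborhood_in (subtopology (HM_topology X) (HM_map l ` HM_set X)) (HM_map l f)
        (WW \<inter> HM_map l ` HM_set X)"
      using f lH by (subst neighborhood_in_subtopology) auto
    have "g \<in> HM_close X f V \<epsilon>" if g: "g \<in> HM_set X" "HM_map l g \<in> WW"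
      and a: "a \<in> WW" "a \<in> HM_map l ` HM_set X" "HM_mult m a g \<in> UU" for g a
    proof -
      have aH: "a \<in> HM_set X" using a(1) by (simp add: WW_def HM_close_def)
      have "HM_dev f V g \<subseteq> HM_dev (HM_map l f) W' a \<union> HM_dev f U (HM_mult m a g) \<union>
        HM_dev (HM_map l f) W' (HM_map l g)"
      proof
        fix t assume t: "t \<in> HM_dev f V g"
        then have t': "t \<in> {0..<1}" "g t \<notin> V (f t)" by (auto simp: HM_dev_def)
        \<comment> \<open>This uses that \<open>a\<close> is taken from the subspace:
          \<open>a\<close> is some \<open>l\<close> composed with \<open>h\<close>, so each
          \<open>a t\<close> lies in the image of \<open>l\<close>, as dicontinuity in
          \<open>X\<close> demands.\<close>
        from a(2) obtain h where "h \<in> HM_set X" "a = HM_map l h" by blast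
        then have "a t = l (h t)" "h t \<in> topspace X"
          using t'(1) by (simp_all add: HM_map_apply HM_set_funcset)
        then have "a t \<in> l ` topspace X" by blast
        moreover have "W' (l (f t)) \<subseteq> W (f t)" using t'(1) by (auto simp: W'_def)
        ultimately have "a t \<notin> W' (l (f t)) \<or> m (a t) (g t) \<notin> U (f t) \<or> l (g t) \<notin> W' (l (f t))"
          using UW(3)[of "f t" "a t" "g t"] t' HM_set_funcset[OF g(1) t'(1)] by blast
        with t'(1) show "t \<in> HM_dev (HM_map l f) W' a \<union> HM_dev f U (HM_mult m a g) \<union>
          HM_dev (HM_map l f) W' (HM_map l g)"
          by (auto simp: HM_dev_def HM_map_apply HM_mult_apply)
      qed
      then have "measure lebesgue (HM_dev f V g) \<le> measure lebesgue (HM_dev (HM_map l f) W' a) +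
        measure lebesgue (HM_dev f U (HM_mult m a g)) +
        measure lebesgue (HM_dev (HM_map l f) W' (HM_map l g))"
        using f g aH lH mH by (intro measure_lebesgue_cover3 HM_dev_lmeasurable)
      also have "\<dots> < \<epsilon>" using g(2) a(1,3) by (simp add: UU_def WW_def HM_close_def)
      finally show ?thesis using g(1) by (simp add: HM_close_def)
    qed
    then have "left_quot (HM_topology X) (HM_mult m) (WW \<inter> HM_map l ` HM_set X) UU \<inter>
      {g \<in> HM_set X. HM_map l g \<in> WW \<inter> HM_map l ` HM_set X} \<subseteq> Z"
      using V(3) unfolding left_quot_def by auto
    with UU WW show ?thesis by blast
  qed
  show ?thesis
    unfolding dicontinuous_left_unit_operation_def left_unit_operation_def topspace_HM_topology
    using lH unitH continuous_map_HM_map[OF cont] dicontH by simp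
qed

text \<open>Passing to the opposite multiplication exchanges the two sides, so the argument for left
  units also settles right units.\<close>

lemma dicontinuous_right_eq_left_flip:
  "dicontinuous_right_unit_operation S m r = dicontinuous_left_unit_operation S (\<lambda>x y. m y x) r"
  by (simp add: dicontinuous_right_unit_operation_def dicontinuous_left_unit_operation_def
    right_unit_operation_def left_unit_operation_def right_quot_def left_quot_def)

theorem theorem11:
  fixes X :: "'a topology" and m :: "'a \<Rightarrow> 'a \<Rightarrow> 'a" and l r :: "'a \<Rightarrow> 'a"
  assumes "ditopological_unosemigroup X m l r"
  shows "ditopological_unosemigroup (HM_topology X) (HM_mult m) (HM_map l) (HM_map r)"
proof -
  have X: "topological_semigroup X m" and l: "dicontinuous_left_unit_operation X m l"
    and r: "dicontinuous_left_unit_operation X (\<lambda>x y. m y x) r"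
    using assms
    by (simp_all add: ditopological_unosemigroup_def dicontinuous_right_eq_left_flip)
  note closed = topological_semigroup_closed[OF X]
  \<comment> \<open>Forming the extension commutes with passing to the opposite multiplication,
    which turns the left result for the opposite of \<open>m\<close> into the right result for
    \<open>HM_mult m\<close>.\<close>
  have "HM_mult (\<lambda>x y. m y x) = (\<lambda>f g. HM_mult m g f)"
    by (simp add: HM_mult_def fun_eq_iff)
  then have "dicontinuous_right_unit_operation (HM_topology X) (HM_mult m) (HM_map r)"
    using dicontinuous_left_unit_operation_HM[OF r closed]
    by (simp add: dicontinuous_right_eq_left_flip)
  then show ?thesis
    using topological_semigroup_HM[OF X] dicontinuous_left_unit_operation_HM[OF l closed]
    by (simp add: ditopological_unosemigroup_def)
qed

end
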